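(* Let $d\geq 3$. Then there exists $c>0$ such that the following holds. For every positive integer $n$, there exists a family of $n$ axis-parallel boxes in $\mathbb{R}^{d}$ whose intersection graph $G$ contains no clique and no independent set of size larger than $$cn^{1/2}\left(\frac{\log n}{\log\log n}\right)^{-(d-2)/2}.$$
   Context: Boxes are closed axis-parallel boxes $\prod_{i=1}^d [a_i,b_i]$. The intersection graph of a family of sets has the members of the family as vertices (with multiplicity), two joined by an edge if they have nonempty intersection. The constant $c$ may depend on $d$ only.
   Formalization: The bound is proved for every integer n ≥ 3 rather than every positive integer n, since log n / log log n is undefined at n = 1 and, with natural logarithm, negative at n = 2 (making the claim false there for d = 4). *)

theory Defs
  imports "HOL-Analysis.Analysis" "HOL-Library.Ramsey"
begin

definition axis_parallel_box :: "(real ^ 'd) set \<Rightarrow> bool" where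
  "axis_parallel_box X \<longleftrightarrow> (\<exists>a b. (\<forall>i. a $ i \<le> b $ i) \<and> X = cbox a b)"

(* A family is indexed by a set I, and the vertices of its intersection graph are the
   indices, so that equal members count with multiplicity. Edges are two-element sets,
   as expected by clique and indep of HOL-Library.Ramsey. *)
definition intersection_graph_edges :: "'i set \<Rightarrow> ('i \<Rightarrow> 'a set) \<Rightarrow> 'i set set" where
  "intersection_graph_edges I B = {{i, j} | i j. i \<in> I \<and> j \<in> I \<and> i \<noteq> j \<and> B i \<inter> B j \<noteq> {}}"

end

theory Submission
  imports Defs
begin

text \<open>
  Consider the \<open>b\<close>-adic boxes of volume \<open>b\<^sup>-\<^sup>k\<close> in the unit cube, scaled to the integer grid
  of side \<open>m = b\<^sup>k\<close> and closed up at integer corners. With \<open>t = h\<^sup>d\<^sup>-\<^sup>1\<close> admissible shapes there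
  are \<open>t m\<close> of them, and every point lies in at most \<open>t\<close>. Record, for a set of pairwise disjoint
  boxes, which parents (the box stretched by \<open>b\<close> in one direction) occur. The boxes all of whose
  parents are recorded are again pairwise disjoint, so there are at most \<open>m\<close> of them. Hence every
  independent set lies in one of at most \<open>2 ^ (d t m / b)\<close> containers of size at most \<open>m\<close>. For
  \<open>b = d t\<^sup>2\<close> a union bound shows that some choice of \<open>m\<close> boxes meets every container in
  \<open>O(m / t)\<close> boxes and every point star in \<open>O(h)\<close> boxes. Repeating each chosen box \<open>q\<close> times
  and taking \<open>r\<close> disjoint translates of the result balances cliques against independent sets.
\<close>

section \<open>Cliques and independent sets in terms of the sets themselves\<close>

lemma clique_intersection_graph_iff:
  assumes "S \<subseteq> I"
  shows "clique S (intersection_graph_edges I B) \<longleftrightarrow> pairwise (\<lambda>i j. B i \<inter> B j \<noteq> {}) S"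
  using assms unfolding clique_def intersection_graph_edges_def pairwise_def
  by (auto simp: doubleton_eq_iff Int_commute) blast+

lemma indep_intersection_graph_iff:
  assumes "S \<subseteq> I"
  shows "indep S (intersection_graph_edges I B) \<longleftrightarrow> disjoint_family_on B S"
  using assms unfolding indep_def intersection_graph_edges_def disjoint_family_on_def
  by (auto simp: doubleton_eq_iff Int_commute) blast+

section \<open>Factorial estimate and union bound\<close>

text \<open>Divided by \<open>fact n\<close>, the left side is a single term of the exponential
  series at \<open>real n\<close>, and e is at most 3.\<close>

lemma power_self_le_fact: "real n ^ n \<le> 3 ^ n * fact n"
proof -
  have "(\<lambda>i. real n ^ i /\<^sub>R fact i) sums exp (real n)"
    by (rule exp_converges)
  then have "(\<Sum>i\<in>{n}. real n ^ i /\<^sub>R fact i) \<le> exp (real n)"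
    unfolding sums_iff by (metis (no_types, lifting) finite.emptyI finite.insertI sum_le_suminf
      of_nat_0_le_iff zero_le_power fact_ge_zero inverse_nonnegative_iff_nonnegative scaleR_nonneg_nonneg)
  also have "exp (real n) = exp 1 ^ n"
    by (simp flip: exp_of_nat_mult)
  also have "\<dots> \<le> 3 ^ n"
    by (intro power_mono exp_le) simp
  finally show ?thesis
    by (simp add: field_simps)
qed

text \<open>Fix \<open>s\<close> positions that are sent into \<open>C\<close> and leave the others
  free. A map with more than \<open>s\<close> hits is counted several times, which an upper bound
  allows.\<close>

lemma card_PiE_many_hits_le:
  assumes "finite I" "finite X" "C \<subseteq> X"
  shows "card {f \<in> I \<rightarrow>\<^sub>E X. s \<le> card {i\<in>I. f i \<in> C}}
    \<le> (card I choose s) * (card C ^ s * card X ^ (card I - s))"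
proof -
  let ?H = "\<lambda>J. PiE I (\<lambda>i. if i \<in> J then C else X)"
  let ?Js = "{J. J \<subseteq> I \<and> card J = s}"
  have sub: "{f \<in> I \<rightarrow>\<^sub>E X. s \<le> card {i\<in>I. f i \<in> C}} \<subseteq> (\<Union>J\<in>?Js. ?H J)"
  proof
    fix f assume f: "f \<in> {f \<in> I \<rightarrow>\<^sub>E X. s \<le> card {i\<in>I. f i \<in> C}}"
    then obtain J where "J \<subseteq> {i\<in>I. f i \<in> C}" "card J = s"
      by (metis (lifting) obtain_subset_with_card_n mem_Collect_eq)
    with f show "f \<in> (\<Union>J\<in>?Js. ?H J)"
      by (intro UN_I[of J]) (auto simp: PiE_iff subset_iff)
  qed
  have cardH: "card (?H J) = card C ^ s * card X ^ (card I - s)" if "J \<in> ?Js" for J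
  proof -
    have IJ: "I \<inter> {i. i \<in> J} = J" "I \<inter> - {i. i \<in> J} = I - J"
      using that by auto
    have "card (?H J) = (\<Prod>i\<in>I. card (if i \<in> J then C else X))"
      using assms by (simp add: card_PiE)
    also have "\<dots> = (\<Prod>i\<in>I. if i \<in> J then card C else card X)"
      by (intro prod.cong) auto
    also have "\<dots> = card C ^ card J * card X ^ card (I - J)"
      using assms by (simp only: prod.If_cases IJ prod_constant)
    also have "card (I - J) = card I - s"
      using that assms by (auto simp: card_Diff_subset finite_subset)
    finally show ?thesis using that by simp
  qed
  have "finite ?Js" "finite (?H J)" for J
    using assms finite_subset[of C X] by (auto intro!: finite_PiE)
  then have "card {f \<in> I \<rightarrow>\<^sub>E X. s \<le> card {i\<in>I. f i \<in> C}} \<le> card (\<Union>J\<in>?Js. ?H J)"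
    by (intro card_mono sub) auto
  also have "\<dots> \<le> (\<Sum>J\<in>?Js. card (?H J))"
    by (rule card_UN_le) fact
  also have "\<dots> = (card I choose s) * (card C ^ s * card X ^ (card I - s))"
    by (simp add: cardH n_subsets assms)
  finally show ?thesis .
qed

text \<open>The union bound in counting form. For a uniformly random map, the base of the power in
  \<open>small\<close> is the expected number of hits in \<open>C\<close>, and the summand bounds
  the probability of at least \<open>s\<close> hits.\<close>

lemma exists_map_few_hits:
  fixes K :: "('a set \<times> nat) set"
  assumes fin: "finite I" "finite X" "finite K" and "X \<noteq> {}"
    and K: "\<And>C s. (C, s) \<in> K \<Longrightarrow> C \<subseteq> X"
    and small: "(\<Sum>(C, s)\<in>K. (real (card I) * real (card C) / real (card X)) ^ s / fact s) < 1"
  shows "\<exists>f\<in>I \<rightarrow>\<^sub>E X. \<forall>(C, s)\<in>K. card {i\<in>I. f i \<in> C} < s"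
proof (rule ccontr)
  assume none: "\<not> ?thesis"
  define bad where "bad = (\<lambda>(C, s). {f \<in> I \<rightarrow>\<^sub>E X. s \<le> card {i\<in>I. f i \<in> C}})"
  have X0: "real (card X) > 0" using fin \<open>X \<noteq> {}\<close> by (simp add: card_gt_0_iff)
  have bad: "real (card (bad p)) \<le> real (card X) ^ card I *
      (case p of (C, s) \<Rightarrow> (real (card I) * real (card C) / real (card X)) ^ s / fact s)"
    if pK: "p \<in> K" for p
  proof -
    obtain C s where p: "p = (C, s)" by force
    have le: "card (bad p) \<le> (card I choose s) * (card C ^ s * card X ^ (card I - s))"
      unfolding p bad_def using card_PiE_many_hits_le[of I X C s] fin K pK p by simp
    show ?thesis
    proof (cases "s \<le> card I")
      \<comment> \<open>Treated apart because \<open>card I - s\<close> would truncate here; the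
        binomial coefficient vanishes.\<close>
      case False
      then have "card (bad p) = 0" using le by (simp add: binomial_eq_0)
      then show ?thesis by (simp add: p)
    next
      case True
      have "real (card (bad p)) \<le> real (card I choose s) * (real (card C) ^ s * real (card X) ^ (card I - s))"
        using le by (metis of_nat_le_iff of_nat_mult of_nat_power)
      also have "real (card I choose s) \<le> real (card I) ^ s / fact s"
      proof -
        have "real ((card I choose s) * fact s) \<le> real (card I ^ s)"
          using binomial_fact_pow of_nat_le_iff by blast
        then show ?thesis by (simp add: field_simps)
      qed
      also have "real (card X) ^ (card I - s) = real (card X) ^ card I / real (card X) ^ s"
        using X0 True by (simp add: power_diff)
      finally show ?thesis
        by (simp add: p power_divide power_mult_distrib mult_ac mult_right_mono)
    qed
  qed
  have "I \<rightarrow>\<^sub>E X \<subseteq> (\<Union>p\<in>K. bad p)"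
    using none unfolding bad_def by (force simp: not_less)
  then have "card (I \<rightarrow>\<^sub>E X) \<le> card (\<Union>p\<in>K. bad p)"
    using fin by (intro card_mono finite_UN_I)
      (auto simp: bad_def intro: finite_subset[OF _ finite_PiE[of I "\<lambda>_. X"]])
  also have "\<dots> \<le> (\<Sum>p\<in>K. card (bad p))"
    by (rule card_UN_le) fact
  finally have "real (card X ^ card I) \<le> (\<Sum>p\<in>K. real (card (bad p)))"
    using fin by (simp add: card_PiE flip: of_nat_sum)
  also have "\<dots> \<le> (\<Sum>p\<in>K. real (card X) ^ card I *
      (case p of (C, s) \<Rightarrow> (real (card I) * real (card C) / real (card X)) ^ s / fact s))"
    by (intro sum_mono bad)
  also have "\<dots> = real (card X) ^ card I *
      (\<Sum>(C, s)\<in>K. (real (card I) * real (card C) / real (card X)) ^ s / fact s)"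
    by (simp add: sum_distrib_left)
  also have "\<dots> < real (card X) ^ card I * 1"
    using small X0 by (intro mult_strict_left_mono) auto
  finally show False by simp
qed

section \<open>Boxes of the b-adic grid, their stars and parents\<close>

text \<open>The closed upper end matches the far corner of \<open>real_cell\<close>;
  \<open>w > 0\<close> keeps the subtraction from truncating.\<close>

lemma div_eq_iff_between:
  fixes w z a :: nat
  assumes "w > 0"
  shows "z div w = a \<longleftrightarrow> a * w \<le> z \<and> z \<le> (a + 1) * w - 1"
proof -
  have "z div w = a \<longleftrightarrow> a \<le> z div w \<and> z div w < a + 1"
    by auto
  also have "\<dots> \<longleftrightarrow> a * w \<le> z \<and> z < (a + 1) * w"
    using assms by (simp only: less_eq_div_iff_mult_less_eq div_less_iff_less_mult)
  also have "z < (a + 1) * w \<longleftrightarrow> z \<le> (a + 1) * w - 1"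
    using assms by (intro less_eq_Suc_le[THEN trans]) (auto simp: Suc_le_eq)
  finally show ?thesis .
qed

text \<open>A shape \<open>T\<close> lists the level of subdivision in each direction. The common
  sum gives all boxes the same volume and makes distinct shapes incomparable; positivity lets every
  box be stretched by \<open>b\<close> in every direction.\<close>

locale box_grid =
  fixes b k :: nat and Ts :: "('d::finite \<Rightarrow> nat) set"
  assumes b_pos: "b > 0"
    and finite_Ts: "finite Ts"
    and sum_Ts: "T \<in> Ts \<Longrightarrow> sum T UNIV = k"
    and pos_Ts: "T \<in> Ts \<Longrightarrow> 0 < T i"
begin

text \<open>A box is coded by a pair \<open>(T, a)\<close>: in direction \<open>i\<close> it is the \<open>a i\<close>-th of the \<open>b ^ T i\<close>
  intervals of length \<open>b ^ (k - T i)\<close>.\<close>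

definition boxes :: "(('d \<Rightarrow> nat) \<times> ('d \<Rightarrow> nat)) set" where
  "boxes = Sigma Ts (\<lambda>T. PiE UNIV (\<lambda>i. {..<b ^ T i}))"

definition cell :: "('d \<Rightarrow> nat) \<times> ('d \<Rightarrow> nat) \<Rightarrow> ('d \<Rightarrow> nat) set" where
  "cell p = {z. \<forall>i. z i div b ^ (k - fst p i) = snd p i}"

text \<open>The far corner is the last integer point of the cell, not the start of the next cell.
  Adjacent cells thus become disjoint closed boxes.\<close>

definition real_cell :: "('d \<Rightarrow> nat) \<times> ('d \<Rightarrow> nat) \<Rightarrow> (real ^ 'd) set" where
  "real_cell p = cbox (\<chi> i. real (snd p i * b ^ (k - fst p i)))
     (\<chi> i. real ((snd p i + 1) * b ^ (k - fst p i) - 1))"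

definition star :: "('d \<Rightarrow> nat) \<Rightarrow> (('d \<Rightarrow> nat) \<times> ('d \<Rightarrow> nat)) set" where
  "star z = {p \<in> boxes. z \<in> cell p}"

text \<open>The code keeps the shape before stretching and the direction. Equal codes therefore come
  only from boxes of one shape that differ by a slide in that direction.\<close>

definition parent :: "'d \<Rightarrow> ('d \<Rightarrow> nat) \<times> ('d \<Rightarrow> nat) \<Rightarrow> ('d \<Rightarrow> nat) \<times> 'd \<times> ('d \<Rightarrow> nat)" where
  "parent i p = (fst p, i, (snd p)(i := snd p i div b))"

definition parents :: "(('d \<Rightarrow> nat) \<times> 'd \<times> ('d \<Rightarrow> nat)) set" where
  "parents = (SIGMA T:Ts. SIGMA i:UNIV. PiE UNIV (\<lambda>j. {..<b ^ (if j = i then T j - 1 else T j)}))"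

definition container ::
  "(('d \<Rightarrow> nat) \<times> 'd \<times> ('d \<Rightarrow> nat)) set \<Rightarrow> (('d \<Rightarrow> nat) \<times> ('d \<Rightarrow> nat)) set" where
  "container G = {p \<in> boxes. \<forall>i. parent i p \<in> G}"

lemma le_k: "T \<in> Ts \<Longrightarrow> T i \<le> k"
  using sum_Ts member_le_sum[of i UNIV T] by force

lemma finite_boxes: "finite boxes"
  unfolding boxes_def by (intro finite_SigmaI finite_Ts finite_PiE) auto

lemma finite_parents: "finite parents"
  unfolding parents_def by (intro finite_SigmaI finite_Ts finite_PiE) auto

lemma card_boxes: "card boxes = card Ts * b ^ k"
proof -
  have "card (PiE UNIV (\<lambda>i. {..<b ^ T i})) = b ^ k" if "T \<in> Ts" for T
    using sum_Ts[OF that] by (simp add: card_PiE flip: power_sum)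
  then show ?thesis
    unfolding boxes_def using finite_Ts by (simp add: card_SigmaI finite_PiE)
qed

text \<open>Lowering one level by one loses a factor \<open>b\<close>, and \<open>pos_Ts\<close>
  rules out truncation. This saving over the number of boxes is what keeps the containers
  few.\<close>

lemma card_parents: "card parents = card Ts * CARD('d) * b ^ (k - 1)"
proof -
  have "card (PiE UNIV (\<lambda>j. {..<b ^ (if j = i then T j - 1 else T j)})) = b ^ (k - 1)"
    if T: "T \<in> Ts" for T i
  proof -
    have "(\<Sum>j\<in>UNIV. if j = i then T j - 1 else T j) = (T i - 1) + sum T (UNIV - {i})"
      by (subst sum.remove[of UNIV i]) auto
    also have "\<dots> = k - 1"
      using sum_Ts[OF T] pos_Ts[OF T, of i] sum.remove[of UNIV i T] by simp
    finally have "(\<Sum>j\<in>UNIV. if j = i then T j - 1 else T j) = k - 1" .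
    moreover have "card (PiE UNIV (\<lambda>j. {..<b ^ (if j = i then T j - 1 else T j)}))
        = b ^ (\<Sum>j\<in>UNIV. if j = i then T j - 1 else T j)"
      by (simp only: card_PiE finite card_lessThan power_sum)
    ultimately show ?thesis by simp
  qed
  then show ?thesis
    unfolding parents_def using finite_Ts by (simp add: card_SigmaI finite_SigmaI finite_PiE)
qed

lemma parent_in_parents: "p \<in> boxes \<Longrightarrow> parent i p \<in> parents"
proof -
  assume p: "p \<in> boxes"
  then have T: "fst p \<in> Ts" and a: "\<And>j. snd p j < b ^ fst p j"
    unfolding boxes_def by auto
  have "snd p i div b < b ^ (fst p i - 1)"
    using a[of i] pos_Ts[OF T, of i] b_pos
    by (simp add: div_less_iff_less_mult flip: power_Suc2)
  then show ?thesis
    unfolding parents_def parent_def using T a by auto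
qed

lemma mem_cell_less:
  assumes "p \<in> boxes" "z \<in> cell p"
  shows "z i < b ^ k"
proof -
  have T: "fst p \<in> Ts" and "z i div b ^ (k - fst p i) < b ^ fst p i"
    using assms unfolding boxes_def cell_def by auto
  then have "z i < b ^ fst p i * b ^ (k - fst p i)"
    using b_pos by (simp add: div_less_iff_less_mult)
  then show ?thesis using le_k[OF T, of i] by (simp flip: power_add)
qed

text \<open>A point and a shape determine the box.\<close>

lemma card_star: "card (star z) \<le> card Ts"
proof (rule card_inj_on_le[where f = fst])
  show "inj_on fst (star z)"
    unfolding star_def cell_def inj_on_def by (auto simp: fun_eq_iff prod_eq_iff)
  show "fst ` star z \<subseteq> Ts" unfolding star_def boxes_def by auto
qed (fact finite_Ts)

lemma mem_real_cell: "(\<chi> i. real (z i)) \<in> real_cell p \<longleftrightarrow> z \<in> cell p"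
proof -
  have "b ^ n > 0" for n using b_pos by simp
  then show ?thesis
    unfolding real_cell_def cell_def mem_box_cart mem_Collect_eq vec_lambda_beta of_nat_le_iff
    by (simp only: div_eq_iff_between)
qed

lemma disjoint_cells_if: "real_cell p \<inter> real_cell q = {} \<Longrightarrow> cell p \<inter> cell q = {}"
  using mem_real_cell by blast

lemma real_cell_box: "axis_parallel_box (real_cell p)"
proof -
  have "snd p i * b ^ (k - fst p i) \<le> (snd p i + 1) * b ^ (k - fst p i) - 1" for i
    using div_eq_iff_between[of "b ^ (k - fst p i)" "snd p i * b ^ (k - fst p i)" "snd p i"] b_pos
    by simp
  then show ?thesis
    unfolding axis_parallel_box_def real_cell_def by (metis (mono_tags, lifting) of_nat_le_iff vec_lambda_beta)
qed

text \<open>The upper bound is strict because the closed boxes stop at the last integer point; this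
  later separates translates by multiples of \<open>b ^ k\<close>.\<close>

lemma real_cell_bounds:
  assumes "p \<in> boxes" "x \<in> real_cell p"
  shows "0 \<le> x $ i" "x $ i < real (b ^ k)"
proof -
  have T: "fst p \<in> Ts" and a: "snd p i + 1 \<le> b ^ fst p i"
    using assms unfolding boxes_def by (auto simp: PiE_iff Suc_le_eq)
  have "(snd p i + 1) * b ^ (k - fst p i) \<le> b ^ fst p i * b ^ (k - fst p i)"
    using a by (rule mult_right_mono) simp
  also have "\<dots> = b ^ k" using le_k[OF T, of i] by (simp flip: power_add)
  finally have "(snd p i + 1) * b ^ (k - fst p i) - 1 < b ^ k"
    using zero_less_power[OF b_pos, of k] by linarith
  then have "real ((snd p i + 1) * b ^ (k - fst p i) - 1) < real (b ^ k)"
    by (rule of_nat_less_iff[THEN iffD2])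
  moreover have "real (snd p i * b ^ (k - fst p i)) \<le> x $ i" "x $ i \<le> real ((snd p i + 1) * b ^ (k - fst p i) - 1)"
    using assms(2) unfolding real_cell_def mem_box_cart by simp_all
  ultimately show "0 \<le> x $ i" "x $ i < real (b ^ k)"
    using of_nat_0_le_iff order_trans by (blast, linarith)
qed

text \<open>Helly's property of boxes: in each coordinate the largest lower end lies below every
  upper end. Lower ends are integers, so the common point found this way is a grid point.\<close>

lemma real_cells_helly:
  assumes fin: "finite S" and ne: "S \<noteq> {}"
    and meet: "\<And>p q. p \<in> S \<Longrightarrow> q \<in> S \<Longrightarrow> real_cell p \<inter> real_cell q \<noteq> {}"
  shows "\<exists>z. \<forall>p\<in>S. z \<in> cell p"
proof -
  define lo where "lo = (\<lambda>(p :: ('d \<Rightarrow> nat) \<times> ('d \<Rightarrow> nat)) i. snd p i * b ^ (k - fst p i))"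
  define hi where "hi = (\<lambda>(p :: ('d \<Rightarrow> nat) \<times> ('d \<Rightarrow> nat)) i. (snd p i + 1) * b ^ (k - fst p i) - 1)"
  define z where "z i = Max ((\<lambda>p. lo p i) ` S)" for i
  have lohi: "lo p i \<le> hi q i" if pq: "p \<in> S" "q \<in> S" for p q i
  proof -
    obtain x where "x \<in> real_cell p" "x \<in> real_cell q" using meet[OF pq] by blast
    then have "real (lo p i) \<le> x $ i" "x $ i \<le> real (hi q i)"
      unfolding real_cell_def mem_box_cart lo_def hi_def by simp_all
    then show ?thesis by linarith
  qed
  have "lo p i \<le> z i \<and> z i \<le> hi p i" if p: "p \<in> S" for p i
  proof
    show "lo p i \<le> z i" unfolding z_def using fin p by (intro Max_ge) auto
    have "z i \<in> (\<lambda>p. lo p i) ` S" unfolding z_def using fin ne by (intro Max_in) auto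
    then obtain q where "q \<in> S" "z i = lo q i" by blast
    then show "z i \<le> hi p i" using lohi[OF _ p] by simp
  qed
  then have "z \<in> cell p" if "p \<in> S" for p
    using that b_pos unfolding cell_def lo_def hi_def by (simp add: div_eq_iff_between)
  then show ?thesis by blast
qed


section \<open>Volume bound and containers for disjoint boxes\<close>

lemma cell_nonempty: "cell p \<noteq> {}"
proof -
  have "(\<lambda>i. snd p i * b ^ (k - fst p i)) \<in> cell p"
    unfolding cell_def using b_pos by simp
  then show ?thesis by blast
qed

lemma card_cell: "finite (cell p)" "p \<in> boxes \<Longrightarrow> card (cell p) = b ^ (k * (CARD('d) - 1))"
proof -
  have b0: "b ^ e > 0" for e using b_pos by simp
  have *: "cell p = PiE UNIV (\<lambda>i. {snd p i * b ^ (k - fst p i)..<snd p i * b ^ (k - fst p i) + b ^ (k - fst p i)})"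
    unfolding cell_def
    by (auto simp: PiE_iff div_eq_iff_between[OF b0]; use b0 in \<open>auto simp: add.commute\<close>)
       (metis Suc_pred add_gr_0 b0 le_imp_less_Suc add.commute less_Suc_eq_le)+
  show "finite (cell p)" unfolding * by (intro finite_PiE) auto
  assume p: "p \<in> boxes"
  then have T: "fst p \<in> Ts" by (auto simp: boxes_def)
  have "card (cell p) = b ^ (\<Sum>i\<in>UNIV. k - fst p i)"
    unfolding * by (simp add: card_PiE flip: power_sum)
  also have "(\<Sum>i\<in>UNIV. k - fst p i) = (\<Sum>i\<in>(UNIV::'d set). k) - sum (fst p) UNIV"
    using le_k[OF T] by (intro sum_subtractf_nat) auto
  also have "\<dots> = k * (CARD('d) - 1)"
    using sum_Ts[OF T] by (simp add: algebra_simps diff_mult_distrib2)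
  finally show "card (cell p) = b ^ (k * (CARD('d) - 1))" .
qed

text \<open>Volume count: each cell fills the fraction \<open>1 / b ^ k\<close> of the grid cube of
  side \<open>b ^ k\<close>.\<close>

lemma card_disjoint_cells_le:
  assumes S: "S \<subseteq> boxes" and disj: "disjoint_family_on cell S"
  shows "card S \<le> b ^ k"
proof -
  let ?e = "k * (CARD('d) - 1)"
  have fin: "finite S" using S finite_boxes by (rule finite_subset)
  have "card S * b ^ ?e = (\<Sum>p\<in>S. card (cell p))"
    using S by (subst sum.cong[OF refl card_cell(2)]) auto
  also have "\<dots> = card (\<Union>p\<in>S. cell p)"
    using fin disj by (intro card_UN_disjoint[symmetric])
      (auto simp: card_cell disjoint_family_on_def)
  also have "\<dots> \<le> card (PiE (UNIV::'d set) (\<lambda>_. {..<b ^ k}))"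
    using S mem_cell_less by (intro card_mono finite_PiE) auto
  also have "\<dots> = b ^ (k * CARD('d))"
    by (simp add: card_PiE power_mult)
  also have "k * CARD('d) = k + ?e"
    by (metis One_nat_def Suc_pred mult_Suc_right zero_less_card_finite)
  finally show ?thesis
    using b_pos by (simp add: power_add)
qed

text \<open>The interval numbered \<open>a1\<close> at the finer level \<open>t'\<close> has the
  same parent as the one containing \<open>z\<close>. This parent has level \<open>t' - 1\<close>,
  at least \<open>t\<close>, so it lies inside a single interval of level \<open>t\<close>.\<close>

lemma div_pow_div_pow:
  assumes "t < t'" "t' \<le> k" "a1 div b = z div b ^ (k - t') div b"
  shows "a1 * b ^ (k - t') div b ^ (k - t) = z div b ^ (k - t)"
proof -
  obtain e where e: "t' = t + Suc e" using assms(1) less_iff_Suc_add by auto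
  have kt: "b ^ (k - t) = b ^ (k - t') * (b * b ^ e)"
  proof -
    have "k - t = (k - t') + Suc e" using assms(2) e by simp
    then show ?thesis by (simp add: power_add)
  qed
  have "a1 * b ^ (k - t') div b ^ (k - t) = a1 div b div b ^ e"
    unfolding kt using b_pos by (simp add: div_mult2_eq)
  also have "\<dots> = z div b ^ (k - t)"
    unfolding assms(3) kt by (simp add: div_mult2_eq)
  finally show ?thesis .
qed

text \<open>Let two boxes of the container share a point. If they are distinct, their types
  \<open>T \<noteq> T'\<close> have equal sums, so \<open>T\<close> is coarser in some direction \<open>i\<close> and finer in some
  direction \<open>j\<close>. Sliding the first box in direction \<open>j\<close> and the second in direction \<open>i\<close>
  inside their parents yields two members of \<open>S\<close>, and these still cross.\<close>

lemma disjoint_container: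
  assumes S: "S \<subseteq> boxes" and disj: "disjoint_family_on cell S"
  shows "disjoint_family_on cell (container (\<Union>i. parent i ` S))"
  unfolding disjoint_family_on_def
proof (intro ballI impI)
  let ?G = "\<Union>i. parent i ` S"
  fix p q assume p: "p \<in> container ?G" and q: "q \<in> container ?G" and "p \<noteq> q"
  have T: "fst p \<in> Ts" "fst q \<in> Ts" using p q by (auto simp: container_def boxes_def)
  \<comment> \<open>The code of the parent fixes shape and direction, so whichever member of
    \<open>S\<close> recorded it is a slide of \<open>p\<close> in direction
    \<open>j\<close>.\<close>
  have slide: "\<exists>p'\<in>S. fst p' = fst p \<and> (\<forall>l. l \<noteq> j \<longrightarrow> snd p' l = snd p l) \<and> snd p' j div b = snd p j div b"
    if p: "p \<in> container ?G" for p j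
  proof -
    have "parent j p \<in> ?G" using p by (auto simp: container_def)
    then obtain i p' where "p' \<in> S" "parent j p = parent i p'" by blast
    then show ?thesis
      by (intro bexI[of _ p']) (auto simp: parent_def fun_eq_iff split: if_splits)
  qed
  show "cell p \<inter> cell q = {}"
  proof (rule ccontr)
    assume "cell p \<inter> cell q \<noteq> {}"
    then obtain z where z: "z \<in> cell p" "z \<in> cell q" by blast
    have "fst p \<noteq> fst q"
    proof
      assume "fst p = fst q"
      then have "snd p = snd q" using z unfolding cell_def by (auto simp: fun_eq_iff)
      with \<open>fst p = fst q\<close> \<open>p \<noteq> q\<close> show False by (simp add: prod_eq_iff)
    qed
    have eqsum: "sum (fst p) UNIV = sum (fst q) UNIV" using T sum_Ts by simp
    have coarser: "\<exists>i. f i < g i" if fg: "f \<noteq> g" "sum f UNIV = sum g UNIV" for f g :: "'d \<Rightarrow> nat"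
    proof (rule ccontr)
      assume "\<nexists>i. f i < g i"
      then have ge: "g i \<le> f i" for i by (simp add: not_less)
      obtain i where "f i \<noteq> g i" using fg(1) by blast
      then have "g i < f i" using ge[of i] by simp
      then have "sum g UNIV < sum f UNIV"
        using ge by (intro sum_strict_mono_ex1) auto
      then show False using fg(2) by simp
    qed
    obtain i where i: "fst p i < fst q i" using coarser[OF \<open>fst p \<noteq> fst q\<close> eqsum] by blast
    obtain j where j: "fst q j < fst p j" using coarser[of "fst q" "fst p"] \<open>fst p \<noteq> fst q\<close> eqsum by metis
    obtain p' where p': "p' \<in> S" "fst p' = fst p" "\<And>l. l \<noteq> j \<Longrightarrow> snd p' l = snd p l"
      "snd p' j div b = snd p j div b" using slide[OF p, of j] by blast
    obtain q' where q': "q' \<in> S" "fst q' = fst q" "\<And>l. l \<noteq> i \<Longrightarrow> snd q' l = snd q l"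
      "snd q' i div b = snd q i div b" using slide[OF q, of i] by blast
    have ij: "i \<noteq> j" using i j by auto
    \<comment> \<open>Coordinate \<open>i\<close> moves into \<open>q'\<close> and coordinate
      \<open>j\<close> into \<open>p'\<close>. In direction \<open>i\<close> the first box is the
      coarser one and in direction \<open>j\<close> the second, so neither box is left by the move
      made for the other.\<close>
    define y where "y = z(i := snd q' i * b ^ (k - fst q i), j := snd p' j * b ^ (k - fst p j))"
    have zp: "z l div b ^ (k - fst p l) = snd p l" and zq: "z l div b ^ (k - fst q l) = snd q l" for l
      using z unfolding cell_def by auto
    have "y \<in> cell p'"
      unfolding cell_def mem_Collect_eq
    proof
      fix l
      have "y i div b ^ (k - fst p i) = z i div b ^ (k - fst p i)"
        using div_pow_div_pow[OF i le_k[OF T(2)], of "snd q' i" "z i"] q'(4) zq[of i] ij by (simp add: y_def)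
      then show "y l div b ^ (k - fst p' l) = snd p' l"
        using p'(2,3) zp ij b_pos by (cases "l = i"; cases "l = j") (auto simp: y_def)
    qed
    moreover have "y \<in> cell q'"
      unfolding cell_def mem_Collect_eq
    proof
      fix l
      have "y j div b ^ (k - fst q j) = z j div b ^ (k - fst q j)"
        using div_pow_div_pow[OF j le_k[OF T(1)], of "snd p' j" "z j"] p'(4) zp[of j] ij by (simp add: y_def)
      then show "y l div b ^ (k - fst q' l) = snd q' l"
        using q'(2,3) zq ij b_pos by (cases "l = i"; cases "l = j") (auto simp: y_def)
    qed
    moreover have "p' \<noteq> q'" using p'(2) q'(2) \<open>fst p \<noteq> fst q\<close> by metis
    ultimately show False
      using disj p'(1) q'(1) by (auto simp: disjoint_family_on_def)
  qed
qed

lemma disjoint_subset_container: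
  assumes S: "S \<subseteq> boxes" and disj: "disjoint_family_on cell S"
  shows "\<exists>G\<subseteq>parents. S \<subseteq> container G \<and> card (container G) \<le> b ^ k"
proof (intro exI conjI)
  show "(\<Union>i. parent i ` S) \<subseteq> parents" using S parent_in_parents by auto
  show "S \<subseteq> container (\<Union>i. parent i ` S)" using S by (auto simp: container_def)
  show "card (container (\<Union>i. parent i ` S)) \<le> b ^ k"
    by (intro card_disjoint_cells_le disjoint_container S disj) (auto simp: container_def)
qed

section \<open>Random choice of boxes\<close>

text \<open>The first summand of \<open>small\<close> is the number of sets of parents times the
  probability that \<open>b ^ k\<close> random boxes hit a given container \<open>s\<close> times.
  The second does the same for the stars of grid points with threshold \<open>w\<close>.\<close>

lemma exists_sparse_boxes:
  fixes s w :: nat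
  assumes Ts: "Ts \<noteq> {}"
    and small: "2 ^ (card Ts * CARD('d) * b ^ (k - 1)) * ((real (b ^ k) / real (card Ts)) ^ s / fact s)
      + real ((b ^ k) ^ CARD('d)) / fact w < 1"
  shows "\<exists>B :: nat \<Rightarrow> (real ^ 'd) set.
    (\<forall>j<b ^ k. axis_parallel_box (B j) \<and> (\<forall>x\<in>B j. \<forall>i. 0 \<le> x $ i \<and> x $ i < real (b ^ k))) \<and>
    (\<forall>S\<subseteq>{..<b ^ k}. pairwise (\<lambda>i j. B i \<inter> B j \<noteq> {}) S \<longrightarrow> card S \<le> w) \<and>
    (\<forall>S\<subseteq>{..<b ^ k}. disjoint_family_on B S \<longrightarrow> card S \<le> s)"
proof -
  define m where "m = b ^ k"
  define t where "t = card Ts"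
  have m0: "m > 0" using b_pos by (simp add: m_def)
  have t0: "t > 0" using Ts finite_Ts by (simp add: t_def card_gt_0_iff)
  have cb: "card boxes = t * m" using card_boxes by (simp add: t_def m_def)
  have X0: "boxes \<noteq> {}" using cb m0 t0 by auto
  define Cs where "Cs = {container G | G. G \<subseteq> parents \<and> card (container G) \<le> m}"
  define Zs where "Zs = PiE (UNIV::'d set) (\<lambda>_. {..<m})"
  define K where "K = (\<lambda>C. (C, s)) ` Cs \<union> (\<lambda>z. (star z, w)) ` Zs"
  define W where "W = (\<lambda>(C :: (('d \<Rightarrow> nat) \<times> ('d \<Rightarrow> nat)) set, s).
    (real (card {..<m}) * real (card C) / real (card boxes)) ^ s / fact s)"
  have W0: "W p \<ge> 0" for p by (auto simp: W_def split: prod.splits)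
  have Cs_sub: "Cs \<subseteq> container ` Pow parents" by (auto simp: Cs_def)
  have finC: "finite Cs" using finite_parents by (intro finite_subset[OF Cs_sub]) auto
  have finZ: "finite Zs" by (simp add: Zs_def finite_PiE)
  have cardC: "card Cs \<le> 2 ^ (t * CARD('d) * b ^ (k - 1))"
  proof -
    have "card Cs \<le> card (container ` Pow parents)"
      using finite_parents by (intro card_mono Cs_sub) auto
    also have "\<dots> \<le> card (Pow parents)" using finite_parents by (intro card_image_le) auto
    also have "\<dots> = 2 ^ (t * CARD('d) * b ^ (k - 1))"
      by (simp add: card_Pow finite_parents card_parents t_def)
    finally show ?thesis .
  qed
  have cardZ: "card Zs = m ^ CARD('d)" by (simp add: Zs_def card_PiE)
  have "sum W K \<le> sum W ((\<lambda>C. (C, s)) ` Cs) + sum W ((\<lambda>z. (star z, w)) ` Zs)"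
    unfolding K_def using finC finZ by (subst sum_Un) (auto intro: sum_nonneg W0)
  also have "\<dots> \<le> (\<Sum>C\<in>Cs. W (C, s)) + (\<Sum>z\<in>Zs. W (star z, w))"
    using sum_image_le[OF finC, of W "\<lambda>C. (C, s)"] sum_image_le[OF finZ, of W "\<lambda>z. (star z, w)"] W0
    by (auto simp: comp_def intro!: add_mono)
  \<comment> \<open>A container holds at most \<open>m\<close> of the \<open>t * m\<close> boxes, so
    \<open>m\<close> random choices hit it at most \<open>m / t\<close> times on average. A star
    holds at most \<open>t\<close> boxes, which gives average at most 1 below.\<close>
  also have "(\<Sum>C\<in>Cs. W (C, s)) \<le> (\<Sum>C\<in>Cs. (real m / real t) ^ s / fact s)"
  proof (rule sum_mono)
    fix C assume "C \<in> Cs"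
    then have "real m * real (card C) / real (t * m) \<le> real m * real m / real (t * m)"
      by (intro divide_right_mono mult_left_mono) (auto simp: Cs_def)
    also have "\<dots> = real m / real t" using m0 by simp
    finally have "(real m * real (card C) / real (t * m)) ^ s / fact s \<le> (real m / real t) ^ s / fact s"
      by (intro divide_right_mono power_mono) auto
    then show "W (C, s) \<le> (real m / real t) ^ s / fact s"
      by (simp add: W_def cb)
  qed
  also have "(\<Sum>z\<in>Zs. W (star z, w)) \<le> (\<Sum>z\<in>Zs. 1 / fact w)"
  proof (rule sum_mono)
    fix z assume "z \<in> Zs"
    have "real m * real (card (star z)) / real (t * m) \<le> real m * real t / real (t * m)"
      using card_star[of z] by (intro divide_right_mono mult_left_mono) (auto simp: t_def)
    also have "\<dots> = 1" using m0 t0 by simp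
    finally have "(real m * real (card (star z)) / real (t * m)) ^ w \<le> 1"
      by (intro power_le_one) auto
    then show "W (star z, w) \<le> 1 / fact w"
      by (auto simp: W_def cb intro!: divide_right_mono)
  qed
  also have "(\<Sum>C\<in>Cs. (real m / real t) ^ s / fact s) + (\<Sum>z\<in>Zs. 1 / fact w)
      = real (card Cs) * ((real m / real t) ^ s / fact s) + real (m ^ CARD('d)) / fact w"
    by (simp add: cardZ)
  also have "\<dots> \<le> 2 ^ (t * CARD('d) * b ^ (k - 1)) * ((real m / real t) ^ s / fact s)
      + real (m ^ CARD('d)) / fact w"
    using cardC by (intro add_right_mono mult_right_mono) (auto dest: of_nat_mono[where 'a = real])
  also have "\<dots> < 1" using small by (simp add: m_def t_def)
  finally have "sum W K < 1" by simp
  then have "\<exists>f\<in>{..<m} \<rightarrow>\<^sub>E boxes. \<forall>(C, s)\<in>K. card {i\<in>{..<m}. f i \<in> C} < s"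
    unfolding W_def using finite_boxes X0 finC finZ
    by (intro exists_map_few_hits) (auto simp: K_def Cs_def container_def star_def)
  then obtain f where f: "f \<in> {..<m} \<rightarrow>\<^sub>E boxes"
    and fK: "\<And>C s. (C, s) \<in> K \<Longrightarrow> card {i\<in>{..<m}. f i \<in> C} < s" by blast
  define B where "B = real_cell \<circ> f"
  have fb: "f i \<in> boxes" if "i < m" for i using f that by auto
  have ne: "B i \<noteq> {}" for i
    using cell_nonempty[of "f i"] mem_real_cell[of _ "f i"] unfolding B_def comp_def by blast
  have "card S \<le> w" if S: "S \<subseteq> {..<m}" "pairwise (\<lambda>i j. B i \<inter> B j \<noteq> {}) S" for S
  proof (cases "S = {}")
    case False
    \<comment> \<open>By Helly's property all boxes of a clique lie in one star.\<close>
    have "\<exists>z. \<forall>p\<in>f ` S. z \<in> cell p"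
    proof (rule real_cells_helly)
      show "finite (f ` S)" using S finite_subset by blast
      fix p q assume "p \<in> f ` S" "q \<in> f ` S"
      then obtain i j where "p = f i" "q = f j" "i \<in> S" "j \<in> S" by blast
      then show "real_cell p \<inter> real_cell q \<noteq> {}"
        using S(2) ne[of i] by (cases "i = j") (auto simp: pairwise_def B_def)
    qed (use False in simp)
    then obtain z where z: "\<forall>i\<in>S. z \<in> cell (f i)" by blast
    then have zm: "z \<in> Zs"
      using False S(1) mem_cell_less[OF fb] unfolding Zs_def m_def[symmetric] by (fastforce simp: PiE_iff)
    have "card S \<le> card {i\<in>{..<m}. f i \<in> star z}"
      using z S(1) fb by (intro card_mono) (auto simp: star_def)
    also have "\<dots> < w" using zm by (intro fK) (auto simp: K_def)
    finally show ?thesis by simp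
  qed simp
  moreover have "card S \<le> s" if S: "S \<subseteq> {..<m}" "disjoint_family_on B S" for S
  proof -
    have fS: "f ` S \<subseteq> boxes" using S(1) fb by auto
    have "disjoint_family_on cell (f ` S)"
      using S(2) disjoint_cells_if unfolding disjoint_family_on_def B_def by (metis comp_apply image_iff)
    from disjoint_subset_container[OF fS this]
    obtain G where G: "G \<subseteq> parents" "f ` S \<subseteq> container G" "card (container G) \<le> m"
      unfolding m_def by blast
    \<comment> \<open>Counting indices instead of boxes accounts for repeated values of
      \<open>f\<close>.\<close>
    have "card S \<le> card {i\<in>{..<m}. f i \<in> container G}"
      using G(2) S(1) by (intro card_mono) auto
    also have "\<dots> < s" using G by (intro fK) (auto simp: K_def Cs_def)
    finally show ?thesis by simp
  qed
  moreover have "axis_parallel_box (B j) \<and> (\<forall>x\<in>B j. \<forall>i. 0 \<le> x $ i \<and> x $ i < real m)" if "j < m" for j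
    using real_cell_box real_cell_bounds[OF fb[OF that]] unfolding B_def m_def by simp
  ultimately show ?thesis unfolding m_def[symmetric] by blast
qed

end

section \<open>Choice of shapes, base and thresholds\<close>

text \<open>All coordinates but one range freely over \<open>{1..h}\<close>. The last one is forced
  by the sum, and it is positive because the others add up to at most
  \<open>(CARD('d) - 1) * h\<close>.\<close>

lemma exists_types:
  assumes "h \<ge> 1"
  shows "\<exists>Ts :: ('d::finite \<Rightarrow> nat) set. finite Ts \<and> card Ts = h ^ (CARD('d) - 1) \<and>
    (\<forall>T\<in>Ts. sum T UNIV = CARD('d) * h \<and> (\<forall>i. 0 < T i))"
proof -
  obtain i0 :: 'd where True by blast
  define A where "A = PiE (UNIV - {i0}) (\<lambda>_. {1..h})"
  define F where "F g = g(i0 := CARD('d) * h - sum g (UNIV - {i0}))" for g :: "'d \<Rightarrow> nat"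
  have card_diff: "card (UNIV - {i0}) = CARD('d) - 1" by (simp add: card_Diff_singleton)
  have inj: "inj_on F A"
  proof (rule inj_onI)
    fix g g' assume gg: "g \<in> A" "g' \<in> A" "F g = F g'"
    show "g = g'"
    proof
      fix i
      show "g i = g' i"
      proof (cases "i = i0")
        \<comment> \<open>Members of \<open>A\<close> are extensional, so both are
          \<open>undefined\<close> at \<open>i0\<close>.\<close>
        case True
        then show ?thesis using gg(1,2) unfolding A_def by (auto simp: PiE_def extensional_def)
      next
        case False
        then show ?thesis using fun_cong[OF gg(3), of i] by (simp add: F_def)
      qed
    qed
  qed
  have "card (F ` A) = h ^ (CARD('d) - 1)"
    using card_image[OF inj] by (simp add: A_def card_PiE card_diff)
  moreover have "finite (F ` A)" by (simp add: A_def finite_PiE)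
  moreover have "sum (F g) UNIV = CARD('d) * h \<and> (\<forall>i. 0 < F g i)" if g: "g \<in> A" for g
  proof -
    have "sum g (UNIV - {i0}) \<le> (\<Sum>i\<in>UNIV - {i0}. h)"
      using g by (intro sum_mono) (auto simp: A_def PiE_iff)
    also have "\<dots> = (CARD('d) - 1) * h" by (simp add: card_diff)
    also have "\<dots> < CARD('d) * h" using assms by (intro mult_strict_right_mono) auto
    finally have lt: "sum g (UNIV - {i0}) < CARD('d) * h" .
    have "sum (F g) UNIV = F g i0 + sum (F g) (UNIV - {i0})" by (rule sum.remove) auto
    also have "sum (F g) (UNIV - {i0}) = sum g (UNIV - {i0})" by (rule sum.cong) (auto simp: F_def)
    finally have "sum (F g) UNIV = CARD('d) * h" using lt by (simp add: F_def)
    moreover have "0 < F g i" for i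
      using lt g by (auto simp: F_def A_def PiE_iff Suc_le_eq)
    ultimately show ?thesis by blast
  qed
  ultimately show ?thesis by (intro exI[of _ "F ` A"]) auto
qed

text \<open>With \<open>12 = 3 * 4\<close>, the factor 3 pays for \<open>power_self_le_fact\<close>,
  and the factor 4 makes each of the \<open>12 * u\<close> factors at most 1/4, which beats the
  \<open>2 ^ u\<close> containers.\<close>

lemma fact_bound_independent:
  assumes "u \<ge> 1"
  shows "2 ^ u * (real u ^ (12 * u) / fact (12 * u)) < 1 / 2"
proof -
  have "real u ^ (12 * u) * 4 ^ (12 * u) * 3 ^ (12 * u) = real (12 * u) ^ (12 * u)"
  proof -
    have "real (12 * u) = real u * 4 * 3" by simp
    then show ?thesis by (simp only: power_mult_distrib)
  qed
  also have "\<dots> \<le> 3 ^ (12 * u) * fact (12 * u)" by (rule power_self_le_fact)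
  finally have "real u ^ (12 * u) * 4 ^ (12 * u) \<le> fact (12 * u)" by simp
  then have "real u ^ (12 * u) / fact (12 * u) \<le> 1 / 4 ^ (12 * u)"
    by (simp add: divide_simps mult.commute)
  then have "2 ^ u * (real u ^ (12 * u) / fact (12 * u)) \<le> 2 ^ u * (1 / 4 ^ (12 * u))"
    by (intro mult_left_mono) auto
  also have "(4::real) ^ (12 * u) = 16777216 ^ u"
    by (simp add: power_mult)
  also have "2 ^ u * (1 / 16777216 ^ u) = (2 / 16777216 :: real) ^ u"
    by (simp only: power_divide times_divide_eq_right mult_1_right)
  also have "\<dots> \<le> (2 / 16777216) ^ 1" using assms by (intro power_decreasing) auto
  finally show ?thesis by (rule le_less_trans) simp
qed

text \<open>The numerator is the number of grid points, a product of powers of \<open>d\<close> and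
  \<open>h\<close>. With \<open>w = 2 * d ^ 3 * h\<close> both exponents are at most
  \<open>w\<close>, while \<open>fact w\<close> is at least \<open>(w / 3) ^ w\<close>, hence at
  least \<open>(d * h) ^ w\<close>.\<close>

lemma fact_bound_clique:
  fixes d h :: nat
  assumes "d \<ge> 3" "h \<ge> 1"
  shows "real (((d * (h ^ (d - 1))\<^sup>2) ^ (d * h)) ^ d) / fact (2 * d ^ 3 * h) < 1 / 2"
proof -
  define w where "w = 2 * d ^ 3 * h"
  have "(h ^ (d - 1))\<^sup>2 = h ^ (2 * (d - 1))"
    by (simp only: mult.commute flip: power_mult)
  then have e: "((d * (h ^ (d - 1))\<^sup>2) ^ (d * h)) ^ d = d ^ (d * h * d) * h ^ (2 * (d - 1) * (d * h) * d)"
    by (simp only: power_mult_distrib power_mult)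
  have w3: "d * h * 3 \<le> w"
  proof -
    have "3 * 1 * (d * h) \<le> 2 * d * d * (d * h)" using assms by (intro mult_right_mono mult_mono) auto
    then show ?thesis by (simp add: w_def power3_eq_cube mult_ac)
  qed
  have exp1: "d * h * d + 1 \<le> w"
  proof -
    have "1 \<le> d * h * d" using assms by simp
    then have "d * h * d + 1 \<le> 2 * (d * h * d)" by simp
    also have "\<dots> \<le> d * (2 * (d * h * d))" using assms by simp
    also have "\<dots> = w" by (simp add: w_def power3_eq_cube mult_ac)
    finally show ?thesis .
  qed
  have exp2: "2 * (d - 1) * (d * h) * d \<le> w"
  proof -
    have "2 * (d - 1) * (d * h) * d \<le> 2 * d * (d * h) * d" by (intro mult_right_mono mult_left_mono) auto
    then show ?thesis by (simp add: w_def power3_eq_cube mult_ac)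
  qed
  \<comment> \<open>The 2 comes from the target 1/2 and is absorbed by an extra factor
    \<open>d\<close>, for which \<open>exp1\<close> leaves room.\<close>
  have "2 * (d ^ (d * h * d) * h ^ (2 * (d - 1) * (d * h) * d)) < d * d ^ (d * h * d) * h ^ (2 * (d - 1) * (d * h) * d)"
    using assms by simp
  also have "\<dots> \<le> d ^ w * h ^ w"
    using assms exp1 exp2 power_increasing[OF exp1, of d] by (intro mult_mono power_increasing) auto
  also have "\<dots> = (d * h) ^ w" by (simp add: power_mult_distrib)
  finally have A: "real (2 * (d ^ (d * h * d) * h ^ (2 * (d - 1) * (d * h) * d))) < real ((d * h) ^ w)"
    by (rule of_nat_less_iff[THEN iffD2])
  have "real (d * h) ^ w * 3 ^ w = real (d * h * 3) ^ w"
    by (simp add: power_mult_distrib)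
  also have "\<dots> \<le> real w ^ w"
    using w3 by (intro power_mono of_nat_mono) auto
  also have "\<dots> \<le> 3 ^ w * fact w" by (rule power_self_le_fact)
  finally have "real ((d * h) ^ w) \<le> fact w" by simp
  with A have "2 * real (((d * (h ^ (d - 1))\<^sup>2) ^ (d * h)) ^ d) < fact w"
    unfolding e by simp
  then show ?thesis unfolding w_def[symmetric] by (simp add: divide_simps)
qed

text \<open>The equation for \<open>s\<close> is the division-free form of twelve times the mean
  number of hits in a full container, \<open>m\<close> over the number of shapes.\<close>

lemma exists_sparse_family:
  fixes h :: nat
  assumes d: "CARD('d::finite) = d" "d \<ge> 3" and "h \<ge> 1"
    and b: "b = d * (h ^ (d - 1))\<^sup>2" and m: "m = b ^ (d * h)"
  shows "\<exists>(B :: nat \<Rightarrow> (real ^ 'd) set) s. s * h ^ (d - 1) = 12 * m \<and>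
    (\<forall>j<m. axis_parallel_box (B j) \<and> (\<forall>x\<in>B j. \<forall>i. 0 \<le> x $ i \<and> x $ i < real m)) \<and>
    (\<forall>S\<subseteq>{..<m}. pairwise (\<lambda>i j. B i \<inter> B j \<noteq> {}) S \<longrightarrow> card S \<le> 2 * d ^ 3 * h) \<and>
    (\<forall>S\<subseteq>{..<m}. disjoint_family_on B S \<longrightarrow> card S \<le> s)"
proof -
  obtain Ts :: "('d \<Rightarrow> nat) set" where Ts: "finite Ts" "card Ts = h ^ (d - 1)"
    "\<forall>T\<in>Ts. sum T UNIV = d * h \<and> (\<forall>i. 0 < T i)"
    using exists_types[where 'd = 'd, OF \<open>h \<ge> 1\<close>] unfolding d(1) by blast
  define t where "t = h ^ (d - 1)"
  have t0: "t \<ge> 1" using \<open>h \<ge> 1\<close> by (simp add: t_def)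
  have b0: "b > 0" using d \<open>h \<ge> 1\<close> by (simp add: b)
  interpret box_grid b "d * h" Ts
    using Ts b0 by unfold_locales auto
  \<comment> \<open>This is the number of parents. The choice \<open>b = d * t\<^sup>2\<close> makes
    it equal to \<open>m / t\<close>, so the exponent of 2 and the mean number of hits
    coincide.\<close>
  define u where "u = d * t * b ^ (d * h - 1)"
  have "d * h \<noteq> 0" using d \<open>h \<ge> 1\<close> by simp
  then have mu: "m = t * u"
    unfolding m u_def using power_minus_mult[of "d * h" b] by (simp add: b power2_eq_square t_def mult_ac)
  have u0: "u \<ge> 1" using d \<open>h \<ge> 1\<close> b0 by (simp add: u_def t_def Suc_le_eq)
  have e: "card Ts * d * b ^ (d * h - 1) = u" by (simp add: Ts d u_def t_def)
  have ratio: "real m / real (card Ts) = real u" using \<open>h \<ge> 1\<close> by (simp add: mu Ts t_def)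
  have small: "2 ^ u * (real u ^ (12 * u) / fact (12 * u)) + real (m ^ d) / fact (2 * d ^ 3 * h) < 1"
    using fact_bound_independent[OF u0] fact_bound_clique[OF d(2) \<open>h \<ge> 1\<close>]
    unfolding m b by linarith
  have "Ts \<noteq> {}" using Ts(2) \<open>h \<ge> 1\<close> by auto
  from exists_sparse_boxes[OF this, of "12 * u" "2 * d ^ 3 * h", unfolded d(1), folded m,
      unfolded e ratio, OF small]
  have "\<exists>B :: nat \<Rightarrow> (real ^ 'd) set.
    (\<forall>j<m. axis_parallel_box (B j) \<and> (\<forall>x\<in>B j. \<forall>i. 0 \<le> x $ i \<and> x $ i < real m)) \<and>
    (\<forall>S\<subseteq>{..<m}. pairwise (\<lambda>i j. B i \<inter> B j \<noteq> {}) S \<longrightarrow> card S \<le> 2 * d ^ 3 * h) \<and>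
    (\<forall>S\<subseteq>{..<m}. disjoint_family_on B S \<longrightarrow> card S \<le> 12 * u)"
    .
  then obtain B :: "nat \<Rightarrow> (real ^ 'd) set" where
    "\<forall>j<m. axis_parallel_box (B j) \<and> (\<forall>x\<in>B j. \<forall>i. 0 \<le> x $ i \<and> x $ i < real m)"
    "\<forall>S\<subseteq>{..<m}. pairwise (\<lambda>i j. B i \<inter> B j \<noteq> {}) S \<longrightarrow> card S \<le> 2 * d ^ 3 * h"
    "\<forall>S\<subseteq>{..<m}. disjoint_family_on B S \<longrightarrow> card S \<le> 12 * u"
    by blast
  then show ?thesis
    by (intro exI[of _ B] exI[of _ "12 * u"]) (simp add: mu t_def)
qed

section \<open>Repetition and translation\<close>

text \<open>Each box is repeated \<open>q\<close> times and the whole is placed in \<open>r\<close>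
  disjoint translates. A clique stays in one translate and gains only the factor \<open>q\<close>;
  an independent set uses one repetition per box and gains only the factor \<open>r\<close>.\<close>

lemma exists_blow_up:
  fixes B :: "nat \<Rightarrow> (real ^ 'd::finite) set"
  assumes box: "\<And>j. j < m \<Longrightarrow> axis_parallel_box (B j)"
    and bounds: "\<And>j x i. j < m \<Longrightarrow> x \<in> B j \<Longrightarrow> 0 \<le> x $ i \<and> x $ i < real m"
    and cliq: "\<And>S. S \<subseteq> {..<m} \<Longrightarrow> pairwise (\<lambda>i j. B i \<inter> B j \<noteq> {}) S \<Longrightarrow> card S \<le> w"
    and ind: "\<And>S. S \<subseteq> {..<m} \<Longrightarrow> disjoint_family_on B S \<Longrightarrow> card S \<le> s"
    and n: "n \<le> m * q * r"
  shows "\<exists>B' :: nat \<Rightarrow> (real ^ 'd) set. (\<forall>i\<in>{..<n}. axis_parallel_box (B' i)) \<and>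
    (\<forall>S\<subseteq>{..<n}. pairwise (\<lambda>i j. B' i \<inter> B' j \<noteq> {}) S \<longrightarrow> card S \<le> w * q) \<and>
    (\<forall>S\<subseteq>{..<n}. disjoint_family_on B' S \<longrightarrow> card S \<le> s * r)"
proof (cases "n = 0")
  case True
  then show ?thesis by auto
next
  case False
  with n have m0: "m > 0" and q0: "q > 0" by (auto intro: Nat.gr0I)
  \<comment> \<open>Mixed-radix digits of an index: \<open>i mod m\<close> names the box,
    \<open>i div m mod q\<close> the repetition and \<open>i div (m * q)\<close> the
    translate.\<close>
  define vertex where "vertex i = i mod m" for i
  define copy where "copy i = i div (m * q)" for i
  define shift :: "nat \<Rightarrow> real ^ 'd" where "shift i = (\<chi> j. real m * real (copy i))" for i
  define B' where "B' i = (+) (shift i) ` B (vertex i)" for i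
  have vm: "vertex i < m" for i using m0 by (simp add: vertex_def)
  have copy_r: "copy i < r" if "i < n" for i
    using that n m0 q0 by (simp add: copy_def div_less_iff_less_mult mult_ac)
  have idx: "i = j" if "vertex i = vertex j" "i div m mod q = j div m mod q" "copy i = copy j" for i j
  proof -
    have "x div m = copy x * q + x div m mod q" for x
      by (simp add: copy_def div_mult2_eq)
    then have "i div m = j div m" using that(2,3) by metis
    then show ?thesis
      using that(1) unfolding vertex_def by (metis div_mult_mod_eq)
  qed
  have copy_eq: "copy i = copy j" if meet: "B' i \<inter> B' j \<noteq> {}" for i j
  proof -
    obtain x y where xy: "x \<in> B (vertex i)" "y \<in> B (vertex j)" "shift i + x = shift j + y"
      using meet unfolding B'_def by blast
    \<comment> \<open>The shift is along the diagonal, so any one coordinate separates the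
      translates.\<close>
    obtain l :: 'd where True by blast
    have eq: "real m * real (copy i) + x $ l = real m * real (copy j) + y $ l"
      using arg_cong[OF xy(3), of "\<lambda>v. v $ l"] by (simp add: shift_def)
    have "0 \<le> x $ l" "x $ l < real m" "0 \<le> y $ l" "y $ l < real m"
      using bounds[OF vm xy(1)] bounds[OF vm xy(2)] by auto
    with eq have "real m * (real (copy i) - real (copy j)) < real m * 1"
        "real m * (real (copy j) - real (copy i)) < real m * 1"
      by (simp_all add: algebra_simps)
    then have "real (copy i) - real (copy j) < 1" "real (copy j) - real (copy i) < 1"
      using m0 by (simp_all only: mult_less_cancel_left_pos of_nat_0_less_iff)
    then show ?thesis by linarith
  qed
  have same_copy: "B' i \<inter> B' j \<noteq> {} \<longleftrightarrow> B (vertex i) \<inter> B (vertex j) \<noteq> {}" if "copy i = copy j" for i j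
  proof -
    have "shift i = shift j" using that by (simp add: shift_def)
    then have "B' i \<inter> B' j = (+) (shift i) ` (B (vertex i) \<inter> B (vertex j))"
      unfolding B'_def by (simp add: image_Int)
    then show ?thesis by simp
  qed
  have ne: "B (vertex i) \<noteq> {}" for i
    using box[OF vm, of i] unfolding axis_parallel_box_def by (metis interval_ne_empty_cart(1))
  have "card S \<le> w * q" if S: "S \<subseteq> {..<n}" "pairwise (\<lambda>i j. B' i \<inter> B' j \<noteq> {}) S" for S
  proof -
    have fin: "finite S" using S(1) finite_subset by blast
    have cc: "copy i = copy j" if "i \<in> S" "j \<in> S" for i j
      using S(2) that copy_eq[of i j] by (cases "i = j") (auto simp: pairwise_def)
    have "card S \<le> card (vertex ` S \<times> {..<q})"
    proof (rule card_inj_on_le[where f = "\<lambda>i. (vertex i, i div m mod q)"])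
      show "inj_on (\<lambda>i. (vertex i, i div m mod q)) S"
      proof (rule inj_onI)
        fix i j assume "i \<in> S" "j \<in> S" "(vertex i, i div m mod q) = (vertex j, j div m mod q)"
        then show "i = j" using cc[of i j] idx[of i j] by (simp only: prod.inject)
      qed
      show "(\<lambda>i. (vertex i, i div m mod q)) ` S \<subseteq> vertex ` S \<times> {..<q}"
        using q0 by (intro image_subsetI SigmaI imageI) (simp_all only: lessThan_iff mod_less_divisor)
      show "finite (vertex ` S \<times> {..<q})" using fin by simp
    qed
    also have "\<dots> = card (vertex ` S) * q" by (simp add: card_cartesian_product)
    also have "card (vertex ` S) \<le> w"
    proof (rule cliq)
      show "pairwise (\<lambda>i j. B i \<inter> B j \<noteq> {}) (vertex ` S)"
        unfolding pairwise_def
      proof (intro ballI impI)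
        fix x y assume "x \<in> vertex ` S" "y \<in> vertex ` S" "x \<noteq> y"
        then obtain i j where "i \<in> S" "j \<in> S" "x = vertex i" "y = vertex j" "i \<noteq> j" by blast
        then show "B x \<inter> B y \<noteq> {}"
          using S(2) same_copy[OF cc] by (auto simp: pairwise_def)
      qed
    qed (use vm in auto)
    finally show ?thesis by simp
  qed
  moreover have "card S \<le> s * r" if S: "S \<subseteq> {..<n}" "disjoint_family_on B' S" for S
  proof -
    define L where "L l = {i \<in> S. copy i = l}" for l
    have L: "card (L l) \<le> s" for l
    proof -
      have dist: "B (vertex i) \<inter> B (vertex j) = {}" if "i \<in> L l" "j \<in> L l" "i \<noteq> j" for i j
        using that S(2) same_copy[of i j] by (auto simp: L_def disjoint_family_on_def)
      \<comment> \<open>Two repetitions of one nonempty box in the same translate would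
        meet.\<close>
      have inj: "inj_on vertex (L l)"
        using dist ne by (metis inf.idem inj_onI)
      have "card (vertex ` L l) \<le> s"
      proof (rule ind)
        show "disjoint_family_on B (vertex ` L l)"
          using dist unfolding disjoint_family_on_def by (metis imageE)
      qed (use vm in auto)
      then show ?thesis using card_image[OF inj] by simp
    qed
    have "S = (\<Union>l<r. L l)" using S(1) copy_r by (auto simp: L_def)
    then have "card S \<le> (\<Sum>l<r. card (L l))" by (metis card_UN_le finite_lessThan)
    also have "\<dots> \<le> (\<Sum>l<r. s)" by (intro sum_mono L)
    finally show ?thesis by (simp add: mult.commute)
  qed
  moreover have "axis_parallel_box (B' i)" for i
  proof -
    obtain a c where ac: "\<forall>j. a $ j \<le> c $ j" "B (vertex i) = cbox a c"
      using box[OF vm, of i] unfolding axis_parallel_box_def by blast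
    have "B' i = cbox (shift i + a) (shift i + c)"
      unfolding B'_def ac(2) by (simp add: cbox_translation)
    then show ?thesis
      using ac(1) unfolding axis_parallel_box_def by (intro exI[of _ "shift i + a"] exI[of _ "shift i + c"]) simp
  qed
  ultimately show ?thesis by (intro exI[of _ B']) blast
qed

section \<open>Balancing the two bounds and letting n grow\<close>

text \<open>The blow-up factors are chosen so that the clique bound \<open>w * q\<close> and the
  independence bound \<open>s * r\<close> both come close to the common target \<open>X\<close>. The
  condition \<open>m ^ 3 \<le> n\<close> makes the rounding errors harmless.\<close>

lemma exists_family_sqrt_bound:
  fixes h n :: nat
  assumes d: "CARD('d::finite) = d" "d \<ge> 3" and "h \<ge> 1"
    and m: "m = (d * (h ^ (d - 1))\<^sup>2) ^ (d * h)" and n: "m ^ 3 \<le> n"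
  shows "\<exists>B :: nat \<Rightarrow> (real ^ 'd) set. (\<forall>i\<in>{..<n}. axis_parallel_box (B i)) \<and>
    (\<forall>S\<subseteq>{..<n}. pairwise (\<lambda>i j. B i \<inter> B j \<noteq> {}) S \<or> disjoint_family_on B S \<longrightarrow>
      real (card S) \<le> 38 * real d ^ 3 * sqrt (real n / real h ^ (d - 2)))"
proof -
  obtain B :: "nat \<Rightarrow> (real ^ 'd) set" and s where s: "s * h ^ (d - 1) = 12 * m"
    and B: "\<forall>j<m. axis_parallel_box (B j) \<and> (\<forall>x\<in>B j. \<forall>i. 0 \<le> x $ i \<and> x $ i < real m)"
      "\<forall>S\<subseteq>{..<m}. pairwise (\<lambda>i j. B i \<inter> B j \<noteq> {}) S \<longrightarrow> card S \<le> 2 * d ^ 3 * h"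
      "\<forall>S\<subseteq>{..<m}. disjoint_family_on B S \<longrightarrow> card S \<le> s"
    using exists_sparse_family[OF d \<open>h \<ge> 1\<close> refl m] by blast
  define w where "w = 2 * d ^ 3 * h"
  define Y where "Y = sqrt (real n / real h ^ (d - 2))"
  define X where "X = 24 * real d ^ 3 * Y"
  have d0: "d > 0" and h0: "h > 0" using d \<open>h \<ge> 1\<close> by auto
  have m0: "m > 0" using d0 h0 by (simp add: m)
  have s0: "s > 0" using s m0 by (auto intro: Nat.gr0I)
  have w0: "w > 0" using d0 h0 by (simp add: w_def)
  have hpow: "h ^ (2 * (d - 1)) \<le> m"
  proof -
    have "h ^ (2 * (d - 1)) = (h ^ (d - 1))\<^sup>2" by (simp only: mult.commute flip: power_mult)
    also have "\<dots> \<le> d * (h ^ (d - 1))\<^sup>2" using d0 by simp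
    also have "\<dots> \<le> m"
      unfolding m using d0 h0 by (intro self_le_power) auto
    finally show ?thesis .
  qed
  have hm: "h \<le> m"
    using hpow self_le_power[of h "2 * (d - 1)"] d h0 by linarith
  have "h ^ (d - 2) \<le> h ^ (2 * (d - 1))" using h0 d by (intro power_increasing) auto
  with hpow have h2m: "h ^ (d - 2) \<le> m" by simp
  \<comment> \<open>As \<open>h ^ (d - 2) \<le> m\<close>, the cube in the hypothesis covers the
    square of \<open>m\<close> times this power.\<close>
  have mY: "real m \<le> Y"
  proof -
    have "m\<^sup>2 * h ^ (d - 2) \<le> m\<^sup>2 * m" using h2m by simp
    also have "\<dots> \<le> n" using n by (simp add: power2_eq_square power3_eq_cube)
    finally have "real (m\<^sup>2 * h ^ (d - 2)) \<le> real n" by (rule of_nat_mono)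
    then have "(real m)\<^sup>2 \<le> real n / real h ^ (d - 2)"
      using h0 by (simp add: field_simps)
    then show ?thesis unfolding Y_def by (rule real_le_rsqrt)
  qed
  have Y0: "Y > 0" using mY m0 by linarith
  \<comment> \<open>Rounding up adds at most \<open>w\<close> to \<open>w * q\<close> and at most
    \<open>s\<close> to \<open>s * r\<close>.\<close>
  define q where "q = nat \<lceil>X / real w\<rceil>"
  define r where "r = nat \<lceil>X / real s\<rceil>"
  have X0: "X > 0" using Y0 d0 by (simp add: X_def)
  have q: "X / real w \<le> real q" "real q \<le> X / real w + 1"
    unfolding q_def using X0 w0 by (simp_all add: of_nat_nat real_nat_ceiling_ge)
  have r: "X / real s \<le> real r" "real r \<le> X / real s + 1"
    unfolding r_def using X0 s0 by (simp_all add: of_nat_nat real_nat_ceiling_ge)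
  \<comment> \<open>Here the exponent \<open>d - 2\<close> arises: independent sets save
    \<open>h ^ (d - 1)\<close>, but one factor \<open>h\<close> is spent on the clique bound
    \<open>w\<close>.\<close>
  have sw: "s * w * h ^ (d - 2) = 24 * d ^ 3 * m"
  proof -
    have "h * h ^ (d - 2) = h ^ (d - 1)" using d Suc_diff_Suc[of 1 d] by (simp add: numeral_2_eq_2 flip: power_Suc)
    then have "s * w * h ^ (d - 2) = 2 * d ^ 3 * (s * h ^ (d - 1))"
      by (simp add: w_def mult_ac)
    also have "\<dots> = 24 * d ^ 3 * m" unfolding s by simp
    finally show ?thesis .
  qed
  have d31: "1 \<le> real d ^ 3" using d by (intro one_le_power) auto
  have X2: "real m * (X / real w) * (X / real s) \<ge> real n"
  proof -
    have "real (s * w * h ^ (d - 2)) = real (24 * d ^ 3 * m)" using sw by simp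
    then have sw': "real s * real w = 24 * real d ^ 3 * real m / real h ^ (d - 2)"
      using h0 by (simp add: field_simps)
    have "Y\<^sup>2 = real n / real h ^ (d - 2)" unfolding Y_def by simp
    then have "real n = Y\<^sup>2 * real h ^ (d - 2) * 1" using h0 by simp
    also have "\<dots> \<le> Y\<^sup>2 * real h ^ (d - 2) * (24 * real d ^ 3)"
      using d31 by (intro mult_left_mono) (linarith, simp)
    also have "\<dots> = real m * X\<^sup>2 / (real s * real w)"
      unfolding sw' X_def using m0 d0 h0 by (simp add: field_simps power2_eq_square)
    finally show ?thesis by (simp add: power2_eq_square mult_ac)
  qed
  have "real n \<le> real m * real q * real r"
    using X2 q(1) r(1) X0 s0 w0
    by (elim order_trans) (intro mult_mono mult_left_mono mult_nonneg_nonneg, auto)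
  then have nmqr: "n \<le> m * q * r" by (metis of_nat_le_iff of_nat_mult)
  have YD: "0 \<le> real d ^ 3 * Y" using Y0 by simp
  \<comment> \<open>The rounding errors \<open>w\<close> and \<open>s\<close> are at most 2 and 12
    times \<open>d ^ 3 * Y\<close>; together with the 24 of \<open>X\<close>, the constant 38 covers
    both cases.\<close>
  have wq: "real (w * q) \<le> 38 * real d ^ 3 * Y"
  proof -
    have "real (w * q) \<le> real w * (X / real w + 1)" using q(2) by (simp add: mult_left_mono)
    also have "\<dots> = X + real w" using w0 by (simp add: distrib_left)
    finally have wq': "real (w * q) \<le> X + real w" .
    have "real h \<le> Y" using hm mY by linarith
    then have "real w \<le> 2 * real d ^ 3 * Y" by (simp add: w_def mult_left_mono)
    with wq' YD show ?thesis unfolding X_def by linarith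
  qed
  have sr: "real (s * r) \<le> 38 * real d ^ 3 * Y"
  proof -
    have "s \<le> s * h ^ (d - 1)" using h0 by simp
    then have "real s \<le> 12 * real m" unfolding s by linarith
    also have "\<dots> \<le> 12 * Y" using mY by simp
    also have "\<dots> \<le> 12 * real d ^ 3 * Y" using d31 Y0 by simp
    finally have s_le: "real s \<le> 12 * real d ^ 3 * Y" .
    have "real (s * r) \<le> real s * (X / real s + 1)" using r(2) by (simp add: mult_left_mono)
    also have "\<dots> = X + real s" using s0 by (simp add: distrib_left)
    also note s_le
    finally show ?thesis using YD unfolding X_def by linarith
  qed
  have "\<exists>B' :: nat \<Rightarrow> (real ^ 'd) set. (\<forall>i\<in>{..<n}. axis_parallel_box (B' i)) \<and>
    (\<forall>S\<subseteq>{..<n}. pairwise (\<lambda>i j. B' i \<inter> B' j \<noteq> {}) S \<longrightarrow> card S \<le> w * q) \<and>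
    (\<forall>S\<subseteq>{..<n}. disjoint_family_on B' S \<longrightarrow> card S \<le> s * r)"
    by (rule exists_blow_up[of m B w s, OF _ _ _ _ nmqr]) (use B w_def in auto)
  then obtain B' :: "nat \<Rightarrow> (real ^ 'd) set" where B': "\<forall>i\<in>{..<n}. axis_parallel_box (B' i)"
    "\<forall>S\<subseteq>{..<n}. pairwise (\<lambda>i j. B' i \<inter> B' j \<noteq> {}) S \<longrightarrow> card S \<le> w * q"
    "\<forall>S\<subseteq>{..<n}. disjoint_family_on B' S \<longrightarrow> card S \<le> s * r" by blast
  have "real (card S) \<le> 38 * real d ^ 3 * Y"
    if "S \<subseteq> {..<n}" "pairwise (\<lambda>i j. B' i \<inter> B' j \<noteq> {}) S \<or> disjoint_family_on B' S" for S
  proof -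
    have "card S \<le> w * q \<or> card S \<le> s * r" using B'(2,3) that by blast
    then show ?thesis using wq sr by (meson of_nat_mono order_trans)
  qed
  then show ?thesis using B'(1) unfolding Y_def by blast
qed

text \<open>The choice \<open>h \<approx> ln n / (6 d\<^sup>2 ln (ln n))\<close> keeps the number of boxes before repetition and
  translation below the cube root of \<open>n\<close>.\<close>

lemma exists_family_large:
  assumes d: "CARD('d::finite) = d" "d \<ge> 3" and "n \<ge> 1"
    and L: "1 \<le> ln (ln (real n))" "ln (real d) \<le> ln (ln (real n))"
      "6 * (real d)\<^sup>2 * ln (ln (real n)) \<le> ln (real n)"
  shows "\<exists>B :: nat \<Rightarrow> (real ^ 'd) set. (\<forall>i\<in>{..<n}. axis_parallel_box (B i)) \<and>
    (\<forall>S\<subseteq>{..<n}. pairwise (\<lambda>i j. B i \<inter> B j \<noteq> {}) S \<or> disjoint_family_on B S \<longrightarrow>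
      real (card S) \<le> 38 * real d ^ 3 * (12 * (real d)\<^sup>2) powr ((real d - 2) / 2) * real n powr (1/2)
        * (ln (real n) / ln (ln (real n))) powr (- ((real d - 2) / 2)))"
proof -
  define y where "y = ln (real n)"
  define l where "l = ln y"
  define a where "a = 6 * (real d)\<^sup>2"
  have l1: "1 \<le> l" "ln (real d) \<le> l" "a * l \<le> y" using L by (simp_all add: y_def l_def a_def)
  have a1: "a \<ge> 1" using d one_le_power[of "real d" 2] unfolding a_def by linarith
  have y0: "y > 0" using l1 a1 by (smt (verit) mult_pos_pos)
  define z where "z = y / (a * l)"
  have z1: "z \<ge> 1" using l1 a1 by (simp add: z_def divide_simps)
  define h where "h = nat \<lfloor>z\<rfloor>"
  have h1: "h \<ge> 1" using z1 by (simp add: h_def le_nat_floor)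
  have hz: "real h \<le> z" using z1 by (simp add: h_def)
  \<comment> \<open>Rounding down loses at most a factor 2 since \<open>h \<ge> 1\<close>; this
    turns the 6 of \<open>a\<close> into the 12 of the final constant.\<close>
  have zh: "z \<le> 2 * real h"
  proof -
    have "z < real h + 1" using z1 unfolding h_def by linarith
    then show ?thesis using h1 by simp
  qed
  define m where "m = (d * (h ^ (d - 1))\<^sup>2) ^ (d * h)"
  have m0: "m > 0" using d h1 by (simp add: m_def)
  have "z \<le> y"
  proof -
    have "1 * 1 \<le> a * l" using a1 l1 by (intro mult_mono) auto
    then have "y / (a * l) \<le> y / 1" using y0 by (intro divide_left_mono) auto
    then show ?thesis by (simp add: z_def)
  qed
  then have "real h \<le> y" using hz by simp
  then have lnh: "ln (real h) \<le> l" using h1 y0 by (simp add: l_def)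
  have "real (d * (h ^ (d - 1))\<^sup>2) = real d * real h ^ (2 * (d - 1))"
    by (simp add: mult.commute flip: power_mult)
  then have lnb: "ln (real (d * (h ^ (d - 1))\<^sup>2)) = ln (real d) + real (2 * (d - 1)) * ln (real h)"
    using d h1 by (simp add: ln_mult ln_realpow)
  have "ln (real m) = real (d * h) * (ln (real d) + real (2 * (d - 1)) * ln (real h))"
    unfolding m_def of_nat_power[of _ "d * h"] lnb[symmetric] by (rule ln_realpow)
  \<comment> \<open>Both \<open>ln d\<close> and \<open>ln h\<close> are at most \<open>l\<close>,
    so the bracket is at most \<open>(2 * d - 1) * l\<close>. The 6 in \<open>a\<close> is then
    exactly what leaves a third of \<open>ln n\<close>.\<close>
  also have "\<dots> \<le> real (d * h) * (l + real (2 * (d - 1)) * l)"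
    using l1(2) lnh by (intro mult_left_mono add_mono) auto
  also have "\<dots> \<le> real (d * h) * (2 * real d * l)"
    using d l1(1) by (intro mult_left_mono) (auto simp: algebra_simps of_nat_diff)
  also have "\<dots> = real h * (2 * (real d)\<^sup>2 * l)" by (simp add: power2_eq_square)
  also have "\<dots> \<le> z * (2 * (real d)\<^sup>2 * l)" using hz l1(1) by (intro mult_right_mono) auto
  also have "\<dots> = y / 3" using d l1(1) by (simp add: z_def a_def)
  finally have "ln (real m) \<le> y / 3" .
  then have lnm: "ln (real (m ^ 3)) \<le> ln (real n)"
    using m0 by (simp add: ln_realpow y_def)
  have "0 < real (m ^ 3)" "0 < real n" using m0 \<open>n \<ge> 1\<close> by simp_all
  with lnm have "real (m ^ 3) \<le> real n" by (simp only: ln_le_cancel_iff)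
  then have mn: "m ^ 3 \<le> n" by (simp only: of_nat_le_iff)
  let ?e = "(real d - 2) / 2"
  have "sqrt (real n / real h ^ (d - 2)) \<le> (12 * (real d)\<^sup>2) powr ?e * real n powr (1/2) * (y / l) powr (- ?e)"
  proof -
    have "real h ^ (d - 2) = real h powr real (d - 2)"
      using h1 by (intro powr_realpow[symmetric]) simp
    also have "real (d - 2) = real d - 2" using d by simp
    finally have "sqrt (real n / real h ^ (d - 2)) = sqrt (real n) / sqrt (real h powr (real d - 2))"
      by (simp only: real_sqrt_divide)
    also have "sqrt (real h powr (real d - 2)) = (real h powr (real d - 2)) powr (1/2)"
      by (intro powr_half_sqrt[symmetric]) simp
    also have "\<dots> = real h powr ?e" by (simp only: powr_powr times_divide_eq_right mult_1_right)
    also have "sqrt (real n) / \<dots> = real n powr (1/2) * real h powr (- ?e)"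
    proof -
      have "sqrt (real n) = real n powr (1/2)" by (simp add: powr_half_sqrt)
      then show ?thesis by (simp only: powr_minus divide_inverse)
    qed
    finally have eq: "sqrt (real n / real h ^ (d - 2)) = real n powr (1/2) * real h powr (- ?e)" .
    \<comment> \<open>The exponent is negative, so the lower bound on \<open>h\<close> is the one
      that matters.\<close>
    have "real h powr (- ?e) \<le> (z / 2) powr (- ?e)"
      using d zh z1 by (intro powr_mono2') auto
    also have "z / 2 = (y / l) / (12 * (real d)\<^sup>2)" by (simp add: z_def a_def)
    also have "\<dots> powr (- ?e) = (y / l) powr (- ?e) / (12 * (real d)\<^sup>2) powr (- ?e)"
      by (rule powr_divide)
    also have "\<dots> = (y / l) powr (- ?e) * (12 * (real d)\<^sup>2) powr ?e"
      by (simp only: powr_minus divide_inverse inverse_inverse_eq)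
    finally have "real n powr (1/2) * real h powr (- ?e) \<le>
        real n powr (1/2) * ((y / l) powr (- ?e) * (12 * (real d)\<^sup>2) powr ?e)"
      by (rule mult_left_mono) simp
    then show ?thesis unfolding eq by (simp only: mult_ac)
  qed
  then have "38 * real d ^ 3 * sqrt (real n / real h ^ (d - 2)) \<le>
      38 * real d ^ 3 * ((12 * (real d)\<^sup>2) powr ?e * real n powr (1/2) * (y / l) powr (- ?e))"
    by (rule mult_left_mono) simp
  then have le: "x \<le> 38 * real d ^ 3 * (12 * (real d)\<^sup>2) powr ?e * real n powr (1/2) * (y / l) powr (- ?e)"
    if "x \<le> 38 * real d ^ 3 * sqrt (real n / real h ^ (d - 2))" for x
    using that by (simp only: mult.assoc)
  show ?thesis
    using exists_family_sqrt_bound[OF d h1 m_def mn] le unfolding y_def l_def by blast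
qed

(* The bound is only meaningful for n >= 3: ln (ln n) is undefined for n = 1 and negative
   for n = 2. *)
theorem theorem2:
  assumes "CARD('d::finite) \<ge> 3"
  shows "\<exists>c::real. c > 0 \<and>
    (\<forall>n::nat. n \<ge> 3 \<longrightarrow>
      (\<exists>B :: nat \<Rightarrow> (real ^ 'd) set.
        (\<forall>i\<in>{..<n}. axis_parallel_box (B i)) \<and>
        (\<forall>S. S \<subseteq> {..<n} \<and>
             (clique S (intersection_graph_edges {..<n} B) \<or>
              indep S (intersection_graph_edges {..<n} B)) \<longrightarrow>
             real (card S) \<le> c * real n powr (1/2) *
               (ln (real n) / ln (ln (real n))) powr (- ((real CARD('d) - 2) / 2)))))"
proof -
  define d where "d = CARD('d)"
  have d: "CARD('d) = d" "d \<ge> 3" using assms by (simp_all add: d_def)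
  define f where "f n = real n powr (1/2) * (ln (real n) / ln (ln (real n))) powr (- ((real d - 2) / 2))"
    for n :: nat
  define a where "a = 6 * (real d)\<^sup>2"
  define c1 where "c1 = 38 * real d ^ 3 * (12 * (real d)\<^sup>2) powr ((real d - 2) / 2)"
  have a0: "a > 0" and c10: "c1 > 0" using d by (auto simp: a_def c1_def)
  have "\<forall>\<^sub>F y::real in at_top. 1 \<le> ln y" "\<forall>\<^sub>F y in at_top. ln (real d) \<le> ln y"
    using ln_at_top unfolding filterlim_at_top by (blast, blast)
  moreover have "\<forall>\<^sub>F y::real in at_top. a * ln y \<le> y"
  proof -
    have "\<forall>\<^sub>F y::real in at_top. ln y / y < 1 / a"
      using a0 by (intro order_tendstoD(2)[OF ln_x_over_x_tendsto_0]) simp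
    with eventually_gt_at_top[of "0 :: real"] show ?thesis
      by eventually_elim (use a0 in \<open>simp add: field_simps\<close>)
  qed
  ultimately have "\<forall>\<^sub>F y in at_top. 1 \<le> ln y \<and> ln (real d) \<le> ln y \<and> a * ln y \<le> y"
    by (intro eventually_conj)
  then have "\<forall>\<^sub>F n in sequentially. 1 \<le> ln (ln (real n)) \<and> ln (real d) \<le> ln (ln (real n))
      \<and> a * ln (ln (real n)) \<le> ln (real n)"
    by (rule eventually_compose_filterlim[OF _ filterlim_compose[OF ln_at_top filterlim_real_sequentially]])
  then obtain N where N: "\<And>n. n \<ge> N \<Longrightarrow> 1 \<le> ln (ln (real n)) \<and> ln (real d) \<le> ln (ln (real n))
      \<and> a * ln (ln (real n)) \<le> ln (real n)"
    unfolding eventually_sequentially by blast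
  \<comment> \<open>Since e < 3, the iterated logarithm is positive from \<open>n = 3\<close> on. A
    zero base would make \<open>powr\<close> vanish.\<close>
  have f0: "f n > 0" if "n \<ge> 3" for n
  proof -
    have "exp 1 < real n" using e_less_272 that by linarith
    then have "ln (exp 1) < ln (real n)" using that by (subst ln_less_cancel_iff) auto
    then show ?thesis using that by (simp add: f_def)
  qed
  \<comment> \<open>The sum absorbs the finitely many \<open>n\<close> below \<open>N\<close>: there
    the trivial bound \<open>card S \<le> n\<close> suffices, and \<open>n\<close> copies of a point
    serve as the family.\<close>
  define c where "c = c1 + (\<Sum>n\<in>{3..<N}. real n / f n)"
  have sum0: "0 \<le> (\<Sum>n\<in>{3..<N}. real n / f n)"
    using f0 by (intro sum_nonneg divide_nonneg_nonneg) (auto intro: less_imp_le)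
  have good: "\<exists>B :: nat \<Rightarrow> (real ^ 'd) set. (\<forall>i\<in>{..<n}. axis_parallel_box (B i)) \<and>
      (\<forall>S\<subseteq>{..<n}. pairwise (\<lambda>i j. B i \<inter> B j \<noteq> {}) S \<or> disjoint_family_on B S \<longrightarrow>
        real (card S) \<le> c * f n)"
    if n: "n \<ge> 3" for n
  proof (cases "n \<ge> N")
    case True
    have le: "c1 * f n \<le> c * f n"
      using sum0 f0[OF n] by (intro mult_right_mono) (auto simp: c_def)
    have e: "38 * real d ^ 3 * (12 * (real d)\<^sup>2) powr ((real d - 2) / 2) * real n powr (1/2)
        * (ln (real n) / ln (ln (real n))) powr (- ((real d - 2) / 2)) = c1 * f n"
      by (simp only: c1_def f_def mult.assoc)
    have "n \<ge> 1" using n by simp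
    from exists_family_large[OF d this] N[OF True] obtain B :: "nat \<Rightarrow> (real ^ 'd) set"
      where B: "\<forall>i\<in>{..<n}. axis_parallel_box (B i)"
        "\<forall>S\<subseteq>{..<n}. pairwise (\<lambda>i j. B i \<inter> B j \<noteq> {}) S \<or> disjoint_family_on B S \<longrightarrow>
          real (card S) \<le> c1 * f n"
      unfolding e a_def by blast
    have "real (card S) \<le> c * f n"
      if "S \<subseteq> {..<n}" "pairwise (\<lambda>i j. B i \<inter> B j \<noteq> {}) S \<or> disjoint_family_on B S" for S
      using B(2) that le order_trans by blast
    with B(1) show ?thesis by blast
  next
    case False
    have "real (card S) \<le> c * f n" if "S \<subseteq> {..<n}" for S
    proof -
      have "card S \<le> n" using card_mono[OF _ that] by simp
      then have "real (card S) \<le> real n / f n * f n" using f0[OF n] by simp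
      also have "real n / f n \<le> (\<Sum>n\<in>{3..<N}. real n / f n)"
        using False n f0 by (intro member_le_sum) (auto intro: less_imp_le)
      also have "\<dots> \<le> c" using c10 by (simp add: c_def)
      finally show ?thesis using f0[OF n] by simp
    qed
    moreover have "axis_parallel_box (cbox 0 0 :: (real ^ 'd) set)"
      unfolding axis_parallel_box_def by blast
    ultimately show ?thesis by (intro exI[of _ "\<lambda>_. cbox 0 0"]) simp
  qed
  have "\<exists>B :: nat \<Rightarrow> (real ^ 'd) set. (\<forall>i\<in>{..<n}. axis_parallel_box (B i)) \<and>
      (\<forall>S. S \<subseteq> {..<n} \<and> (clique S (intersection_graph_edges {..<n} B) \<or>
        indep S (intersection_graph_edges {..<n} B)) \<longrightarrow> real (card S) \<le> c * f n)"
    if "n \<ge> 3" for n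
    using good[OF that] clique_intersection_graph_iff indep_intersection_graph_iff by metis
  moreover have "c > 0" using c10 sum0 by (simp add: c_def)
  ultimately show ?thesis
    unfolding f_def d_def mult.assoc by blast
qed

end
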